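(* Let $\gamma\in\mathbb{R}\setminus\{0\}$, $0<q<\infty$, and $f\in C_c^1(\mathbb{R}^n)$. For every $x\in\mathbb{R}^n$, with $$E_x^{(1)}(f,\lambda,q,\gamma):=\{y\in\mathbb{R}^n:|f(x)-f(y)|>\lambda|x-y|^{1+\gamma/q}\},\qquad \lambda>0,$$ one has $$\lim_{\lambda\to\infty}\lambda\left(\int_{E_x^{(1)}(f,\lambda,q,\gamma)}|x-y|^{\gamma-n}\,dy\right)^{1/q}=\frac{K_{n,q}^{1/q}}{\gamma^{1/q}}|\nabla f(x)|\quad\text{if }\gamma>0,$$ $$\lim_{\lambda\to0^+}\lambda\left(\int_{E_x^{(1)}(f,\lambda,q,\gamma)}|x-y|^{\gamma-n}\,dy\right)^{1/q}=\frac{K_{n,q}^{1/q}}{(-\gamma)^{1/q}}|\nabla f(x)|\quad\text{if }\gamma<0.$$ Moreover, $$\sup_{\lambda>0}\lambda\left(\int_{E_x^{(1)}(f,\lambda,q,\gamma)}|x-y|^{\gamma-n}\,dy\right)^{1/q}\le|\gamma|^{-1/q}\left(\int_{\mathbb S^{n-1}}M_\theta(|\nabla f|)(x)^q\,d\theta\right)^{1/q}.$$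
   Context: $K_{n,q}:=\int_{\mathbb S^{n-1}}|e\cdot\theta|^q\,d\theta$ for any $e\in\mathbb S^{n-1}$ (independent of $e$). For $\theta\in\mathbb S^{n-1}$ the directional maximal operator is $M_\theta g(x):=\sup_{t>0}\frac1t\int_0^t|g(x+r\theta)|\,dr$. *)

theory Defs
  imports "HOL-Analysis.Analysis"
begin

text \<open>All integrals of nonnegative functions are taken in \<open>[0,\<infinity>]\<close> (type \<^typ>\<open>ennreal\<close>), so that no
  finiteness is presupposed. The library has no real powers on this type; only exponents
  \<open>p > 0\<close> are meant here.\<close>

definition ennreal_powr :: "ennreal \<Rightarrow> real \<Rightarrow> ennreal" where
  "ennreal_powr a p = (if a = \<infinity> then \<infinity> else ennreal (enn2real a powr p))"

text \<open>Surface measure on the unit sphere: \<open>\<sigma>(A)\<close> is \<open>n\<close> times the Lebesgue measure of the cone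
  \<open>{r\<theta>. 0 < r < 1, \<theta> \<in> A}\<close>. For \<open>n = 1\<close> this is counting measure on \<open>{-1, 1}\<close>.
  Note \<open>sgn x = x / norm x\<close>.\<close>

definition sphere_measure :: "'a::euclidean_space measure" where
  "sphere_measure = scale_measure (of_nat DIM('a))
     (distr (restrict_space lborel (ball 0 1 - {0})) (restrict_space borel (sphere 0 1)) sgn)"

lemma emeasure_sphere_measure:
  fixes A :: "'a::euclidean_space set"
  assumes "A \<in> sets borel" and "A \<subseteq> sphere 0 1"
  shows "emeasure sphere_measure A
    = of_nat DIM('a) * emeasure lborel {x. 0 < norm x \<and> norm x < 1 \<and> sgn x \<in> A}"
proof -
  let ?B = "ball 0 1 - {0} :: 'a set"
  have meas: "sgn \<in> measurable (restrict_space lborel ?B) (restrict_space borel (sphere 0 1))"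
    by (rule measurable_restrict_space3) (auto simp: norm_sgn sgn_div_norm[abs_def])
  have A: "A \<in> sets (restrict_space borel (sphere 0 1))"
    using assms by (auto simp: sets_restrict_space image_iff)
  have "sgn -` A \<inter> ?B = {x. 0 < norm x \<and> norm x < 1 \<and> sgn x \<in> A}"
    by auto
  moreover have "emeasure (restrict_space lborel ?B) (sgn -` A \<inter> ?B)
      = emeasure lborel (sgn -` A \<inter> ?B)"
    by (rule emeasure_restrict_space) auto
  ultimately show ?thesis
    by (simp add: sphere_measure_def emeasure_distr[OF meas A] space_restrict_space)
qed

text \<open>The constant \<open>K\<^bsub>n,q\<^esub>\<close>, computed with the unit vector \<open>e\<close>.\<close>

definition K_const :: "'a::euclidean_space \<Rightarrow> real \<Rightarrow> ennreal" where
  "K_const e q = (\<integral>\<^sup>+ \<theta>. ennreal (\<bar>e \<bullet> \<theta>\<bar> powr q) \<partial>sphere_measure)"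

definition dir_maximal :: "'a::euclidean_space \<Rightarrow> ('a \<Rightarrow> real) \<Rightarrow> 'a \<Rightarrow> ennreal" where
  "dir_maximal \<theta> g x =
     (SUP t\<in>{0<..}. ennreal (1 / t) * (\<integral>\<^sup>+ r\<in>{0..t}. ennreal \<bar>g (x + r *\<^sub>R \<theta>)\<bar> \<partial>lborel))"

definition gradient :: "('a::euclidean_space \<Rightarrow> real) \<Rightarrow> 'a \<Rightarrow> 'a" where
  "gradient f x = (THE D. GDERIV f x :> D)"

definition C1_compact_support :: "('a::euclidean_space \<Rightarrow> real) \<Rightarrow> bool" where
  "C1_compact_support f \<longleftrightarrow>
     (\<forall>x. f differentiable (at x)) \<and> continuous_on UNIV (gradient f) \<and>
     compact (closure {x. f x \<noteq> 0})"

definition E1 :: "'a::euclidean_space \<Rightarrow> ('a \<Rightarrow> real) \<Rightarrow> real \<Rightarrow> real \<Rightarrow> real \<Rightarrow> 'a set" where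
  "E1 x f l q \<gamma> = {y. \<bar>f x - f y\<bar> > l * norm (x - y) powr (1 + \<gamma> / q)}"

text \<open>The value of the integrand at \<open>y = x\<close> is irrelevant, as \<open>x\<close> is not in the set.\<close>

definition E1_integral :: "'a::euclidean_space \<Rightarrow> ('a \<Rightarrow> real) \<Rightarrow> real \<Rightarrow> real \<Rightarrow> real \<Rightarrow> ennreal" where
  "E1_integral x f l q \<gamma> =
     (\<integral>\<^sup>+ y\<in>E1 x f l q \<gamma>. ennreal (norm (x - y) powr (\<gamma> - real DIM('a))) \<partial>lborel)"

end

(* Taking increments h(z) = f(x + z) - f(x) and substituting z = \<epsilon> w with \<epsilon> = l^(-q/\<gamma>) turns
   l^q times the integral over E1 into the same kind of integral at level 1 for the difference
   quotient (f(x + \<epsilon> w) - f(x)) / \<epsilon>. In both limits of the theorem \<epsilon> tends to 0+, so dominated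
   convergence (f is Lipschitz) gives the integral for the linear function w |-> grad f(x) . w.
   In polar coordinates the radial integral is D^q / |\<gamma>| whenever h(r \<theta>) = r D(\<theta>); with
   D(\<theta>) = |grad f(x) . \<theta>| this is the limit, and with D(\<theta>) = M_\<theta>(|grad f|)(x) >= |h(r \<theta>)| / r it is
   the uniform bound. *)

theory Submission
  imports Defs
begin

text \<open>The kernel |z|^(\<gamma>-n) is not integrable at 0 when \<gamma> < 0 and not at infinity
  when \<gamma> > 0. A bound |h z| \<le> L |z| confines the superlevel set to the harmless side: it
  forces |z|^(\<gamma>/q) < L/l, which describes a ball or the complement of one. So the integral
  for L |z| is a finite majorant, and one argument serves both signs. Dominated convergence also
  needs the indicators of the superlevel sets to converge almost everywhere. They can fail to do so
  only where |z|^(1+\<gamma>/q) = |v . z|, and this set is null because \<gamma> \<noteq> 0 leaves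
  at most one such point on each ray. The constant \<open>K_const e q\<close> is computed with a
  prescribed unit vector \<open>e\<close>, whereas the limit produces the direction of the gradient;
  the invariance of the sphere under reflections closes this gap. In the uniform bound the maximal
  function may be infinite and its measurability is not established, so only monotonicity of the
  integral and an inequality for constant factors are applied to it.\<close>

section \<open>Integration over the sphere and polar coordinates\<close>

lemma nn_integral_lborel_affine:
  fixes g :: "'a::euclidean_space \<Rightarrow> ennreal"
  assumes [measurable]: "g \<in> borel_measurable borel" and "c \<noteq> 0"
  shows "(\<integral>\<^sup>+ x. g x \<partial>lborel) = ennreal (\<bar>c\<bar> ^ DIM('a)) * (\<integral>\<^sup>+ x. g (t + c *\<^sub>R x) \<partial>lborel)"
  by (subst lborel_affine[OF assms(2), of t])
     (simp add: nn_integral_density nn_integral_distr nn_integral_cmult)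

text \<open>Carries sphere integrals back to Lebesgue measure on the punctured unit ball, where
  Tonelli and linear substitutions apply. The polar formula, the invariance under isometries and the
  finiteness of the sphere all rest on it.\<close>

lemma nn_integral_sphere_measure:
  fixes g :: "'a::euclidean_space \<Rightarrow> ennreal"
  assumes [measurable]: "g \<in> borel_measurable borel"
  shows "(\<integral>\<^sup>+ \<theta>. g \<theta> \<partial>sphere_measure)
    = of_nat DIM('a) * (\<integral>\<^sup>+ x. indicator (ball 0 1 - {0}) x * g (sgn x) \<partial>lborel)"
proof -
  let ?B = "ball 0 1 - {0} :: 'a set"
  have meas: "sgn \<in> measurable (restrict_space lborel ?B) (restrict_space borel (sphere 0 1))"
    by (rule measurable_restrict_space3) (auto simp: norm_sgn sgn_div_norm[abs_def])
  have g: "g \<in> borel_measurable (restrict_space borel (sphere 0 1))"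
    by (rule measurable_restrict_space1) measurable
  show ?thesis
    unfolding sphere_measure_def
    using g by (simp add: nn_integral_scale_measure nn_integral_distr[OF meas] nn_integral_restrict_space mult.commute)
qed

lemma space_sphere_measure: "space sphere_measure = (sphere 0 1 :: 'a::euclidean_space set)"
  by (simp add: sphere_measure_def space_restrict_space space_scale_measure)

lemma measurable_sphere_measure:
  "g \<in> borel_measurable borel \<Longrightarrow> g \<in> borel_measurable sphere_measure"
  unfolding sphere_measure_def
  by (subst measurable_cong_sets[OF sets_scale_measure refl]) (simp add: measurable_restrict_space1)

lemma nn_integral_powr_from_0:
  assumes "(a::real) > - 1" and "c \<ge> 0"
  shows "(\<integral>\<^sup>+ r\<in>{0<..<c}. ennreal (r powr a) \<partial>lborel) = ennreal (c powr (a + 1) / (a + 1))"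
proof -
  have "(\<integral>\<^sup>+ r\<in>{0<..<c}. ennreal (r powr a) \<partial>lborel) = (\<integral>\<^sup>+ r\<in>{0..c}. ennreal (r powr a) \<partial>lborel)"
    using AE_lborel_singleton[of 0] AE_lborel_singleton[of c]
    by (intro nn_integral_cong_AE) (auto simp: indicator_def)
  then show ?thesis
    by (simp add: nn_integral_has_integral_lebesgue'[OF _ has_integral_powr_from_0[OF assms]])
qed

lemma nn_integral_powr_to_inf:
  assumes "(a::real) < - 1" and "c > 0"
  shows "(\<integral>\<^sup>+ r\<in>{c<..}. ennreal (r powr a) \<partial>lborel) = ennreal (- (c powr (a + 1)) / (a + 1))"
proof -
  have "(\<integral>\<^sup>+ r\<in>{c<..}. ennreal (r powr a) \<partial>lborel) = (\<integral>\<^sup>+ r\<in>{c..}. ennreal (r powr a) \<partial>lborel)"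
    using AE_lborel_singleton[of c]
    by (intro nn_integral_cong_AE) (auto simp: indicator_def)
  then show ?thesis
    by (simp add: nn_integral_has_integral_lebesgue'[OF _ has_integral_powr_to_inf[OF assms]])
qed

text \<open>Writing \<open>r = s \<parallel>x\<parallel>\<close> in the radial integral over the cone of \<open>sgn x\<close>, exchanging the integrals and
  then substituting \<open>y = s x\<close> reduces the formula to \<open>n \<integral>\<^bsub>s > \<parallel>y\<parallel>\<^esub> s\<^bsup>-n-1\<^esup> ds = \<parallel>y\<parallel>\<^bsup>-n\<^esup>\<close>.\<close>

lemma nn_integral_polar:
  fixes F :: "'a::euclidean_space \<Rightarrow> ennreal"
  assumes [measurable]: "F \<in> borel_measurable borel"
  shows "(\<integral>\<^sup>+ y. F y \<partial>lborel)
    = (\<integral>\<^sup>+ \<theta>. (\<integral>\<^sup>+ r\<in>{0<..}. F (r *\<^sub>R \<theta>) * ennreal (r powr (real DIM('a) - 1)) \<partial>lborel) \<partial>sphere_measure)"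
proof -
  let ?n = "real DIM('a)" and ?B = "ball 0 1 - {0} :: 'a set"
  \<comment> \<open>\<open>?G\<close> is the radial integrand at r = s |x|: the factor |x| from dr
    and (s |x|)^(n-1) combine to s^(n-1) |x|^n. \<open>?H\<close> is the result of y = s x: the
    Jacobian s^(-n) and |x|^n = s^(-n) |y|^n leave |y|^n s^(-n-1), and |x| < 1 becomes |y| <
    s.\<close>
  let ?G = "\<lambda>x s. indicator ?B x * (F (s *\<^sub>R x) * ennreal (s powr (?n - 1) * norm x powr ?n) * indicator {0<..} s)"
  let ?H = "\<lambda>s y. indicator (ball 0 s - {0}) y * (F y * ennreal (norm y powr ?n * s powr (- ?n - 1)))"
  have n: "?n > 0" by simp
  have [measurable]: "?B \<in> sets borel"
    by (intro borel_open open_delete) simp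
  have [measurable]: "Measurable.pred (borel \<Otimes>\<^sub>M borel) (\<lambda>p. norm (snd p :: 'a) < (fst p :: real))"
    by measurable
  \<comment> \<open>The set under the indicator varies with \<open>s\<close>, so joint measurability
    is read off a condition on pairs.\<close>
  have Hm: "(\<lambda>p. ?H (fst p) (snd p)) \<in> borel_measurable (borel \<Otimes>\<^sub>M borel)"
  proof -
    have "(\<lambda>p. ?H (fst p) (snd p)) = (\<lambda>p. (if norm (snd p) < fst p \<and> snd p \<noteq> 0 then 1 else 0) *
        (F (snd p) * ennreal (norm (snd p) powr ?n * fst p powr (- ?n - 1))))"
      by (auto simp: fun_eq_iff indicator_def)
    then show ?thesis by simp
  qed
  have radial: "indicator ?B x * (\<integral>\<^sup>+ r\<in>{0<..}. F (r *\<^sub>R sgn x) * ennreal (r powr (?n - 1)) \<partial>lborel)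
      = (\<integral>\<^sup>+ s. ?G x s \<partial>lborel)" for x
  proof (cases "x = 0")
    case False
    then have nx: "norm x > 0" by simp
    have "(\<integral>\<^sup>+ r\<in>{0<..}. F (r *\<^sub>R sgn x) * ennreal (r powr (?n - 1)) \<partial>lborel)
      = ennreal (norm x) * (\<integral>\<^sup>+ s. F ((norm x * s) *\<^sub>R sgn x) * ennreal ((norm x * s) powr (?n - 1)) * indicator {0<..} (norm x * s) \<partial>lborel)"
      using nx by (subst nn_integral_real_affine[where c="norm x" and t=0]) auto
    also have "\<dots> = (\<integral>\<^sup>+ s. ennreal (norm x) * (F ((norm x * s) *\<^sub>R sgn x) * ennreal ((norm x * s) powr (?n - 1)) * indicator {0<..} (norm x * s)) \<partial>lborel)"
      by (rule nn_integral_cmult[symmetric]) measurable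
    also have "\<dots> = (\<integral>\<^sup>+ s. F (s *\<^sub>R x) * ennreal (s powr (?n - 1) * norm x powr ?n) * indicator {0<..} s \<partial>lborel)"
    proof (rule nn_integral_cong)
      fix s :: real
      show "ennreal (norm x) * (F ((norm x * s) *\<^sub>R sgn x) * ennreal ((norm x * s) powr (?n - 1)) * indicator {0<..} (norm x * s))
        = F (s *\<^sub>R x) * ennreal (s powr (?n - 1) * norm x powr ?n) * indicator {0<..} s"
      proof (cases "s > 0")
        case True
        have "(norm x * s) *\<^sub>R sgn x = s *\<^sub>R x" using nx by (simp add: sgn_div_norm)
        moreover have "norm x * (norm x * s) powr (?n - 1) = s powr (?n - 1) * norm x powr ?n"
          using True nx by (simp add: powr_mult powr_diff)
        ultimately show ?thesis using True nx
          by (simp add: ac_simps flip: ennreal_mult'' )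
             (metis (no_types, lifting) ennreal_mult'' mult.left_commute norm_ge_zero powr_ge_zero mult.commute)
      qed (use nx in \<open>auto simp: indicator_def zero_less_mult_iff\<close>)
    qed
    finally show ?thesis
      by (subst nn_integral_cmult) auto
  qed simp
  have inner: "(\<integral>\<^sup>+ x. ?G x s \<partial>lborel) = (\<integral>\<^sup>+ y. ?H s y \<partial>lborel)" for s
  proof (cases "s > 0")
    case True
    have [measurable]: "(\<lambda>y. ?H s y) \<in> borel_measurable borel"
      using measurable_Pair2[OF Hm, of s] by simp
    have "(\<integral>\<^sup>+ y. ?H s y \<partial>lborel) = ennreal (s ^ DIM('a)) * (\<integral>\<^sup>+ x. ?H s (s *\<^sub>R x) \<partial>lborel)"
      using True by (subst nn_integral_lborel_affine[where c=s and t=0]) auto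
    also have "\<dots> = (\<integral>\<^sup>+ x. ennreal (s ^ DIM('a)) * ?H s (s *\<^sub>R x) \<partial>lborel)"
      by (rule nn_integral_cmult[symmetric]) measurable
    also have "\<dots> = (\<integral>\<^sup>+ x. ?G x s \<partial>lborel)"
    proof (rule nn_integral_cong)
      fix x :: 'a
      have i: "indicator (ball 0 s - {0}) (s *\<^sub>R x) = (indicator ?B x :: ennreal)"
        using True by (auto simp: indicator_def)
      have "s ^ DIM('a) * (norm (s *\<^sub>R x) powr ?n * s powr (- ?n - 1)) = s powr (?n - 1) * norm x powr ?n"
        using True by (simp add: powr_mult powr_diff powr_minus field_simps flip: powr_realpow)
      then have "ennreal (s ^ DIM('a)) * ennreal (norm (s *\<^sub>R x) powr ?n * s powr (- ?n - 1)) = ennreal (s powr (?n - 1) * norm x powr ?n)"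
        using True by (simp flip: ennreal_mult'')
      then show "ennreal (s ^ DIM('a)) * ?H s (s *\<^sub>R x) = ?G x s"
        using True unfolding i by (simp add: ac_simps)  (metis mult.left_commute)
    qed
    finally show ?thesis ..
  next
    case False
    then have "\<not> norm x < s" for x :: 'a
      using norm_ge_zero[of x] by linarith
    with False have "?G x s = ?H s x" for x
      by (auto simp: indicator_def)
    then show ?thesis by (rule nn_integral_cong)
  qed
  \<comment> \<open>At y = 0 the left side vanishes because \<open>?H\<close> excludes the origin,
    whereas \<open>F 0\<close> is arbitrary; the origin is discarded as a null set at the
    end.\<close>
  have outer: "of_nat DIM('a) * (\<integral>\<^sup>+ s. ?H s y \<partial>lborel) = F y" if "y \<noteq> 0" for y
  proof -
    have "(\<integral>\<^sup>+ s. ?H s y \<partial>lborel)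
        = (\<integral>\<^sup>+ s. (F y * ennreal (norm y powr ?n)) * (ennreal (s powr (- ?n - 1)) * indicator {norm y<..} s) \<partial>lborel)"
      using that by (intro nn_integral_cong) (auto simp: indicator_def ennreal_mult'' ac_simps)
    also have "\<dots> = F y * ennreal (norm y powr ?n) * (\<integral>\<^sup>+ s\<in>{norm y<..}. ennreal (s powr (- ?n - 1)) \<partial>lborel)"
      by (rule nn_integral_cmult) measurable
    also have "(\<integral>\<^sup>+ s\<in>{norm y<..}. ennreal (s powr (- ?n - 1)) \<partial>lborel) = ennreal (norm y powr (- ?n) / ?n)"
      using that n by (subst nn_integral_powr_to_inf) auto
    also have "F y * ennreal (norm y powr ?n) * \<dots> = F y * ennreal (1 / ?n)"
      using that n by (simp add: mult.assoc powr_minus field_simps flip: ennreal_mult'')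
    finally have "of_nat DIM('a) * (\<integral>\<^sup>+ s. ?H s y \<partial>lborel) = F y * (ennreal ?n * ennreal (1 / ?n))"
      by (simp add: ac_simps flip: ennreal_of_nat_eq_real_of_nat)
    also have "ennreal ?n * ennreal (1 / ?n) = 1"
      using n by (subst ennreal_mult''[symmetric]) auto
    finally show ?thesis by simp
  qed
  have [measurable]: "(\<lambda>\<theta>. \<integral>\<^sup>+ r\<in>{0<..}. F (r *\<^sub>R \<theta>) * ennreal (r powr (?n - 1)) \<partial>lborel) \<in> borel_measurable borel"
    by measurable
  have "(\<integral>\<^sup>+ \<theta>. (\<integral>\<^sup>+ r\<in>{0<..}. F (r *\<^sub>R \<theta>) * ennreal (r powr (?n - 1)) \<partial>lborel) \<partial>sphere_measure)
    = of_nat DIM('a) * (\<integral>\<^sup>+ x. indicator ?B x * (\<integral>\<^sup>+ r\<in>{0<..}. F (r *\<^sub>R sgn x) * ennreal (r powr (?n - 1)) \<partial>lborel) \<partial>lborel)"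
    by (rule nn_integral_sphere_measure) measurable
  also have "\<dots> = of_nat DIM('a) * (\<integral>\<^sup>+ x. \<integral>\<^sup>+ s. ?G x s \<partial>lborel \<partial>lborel)"
    by (simp only: radial)
  also have "\<dots> = of_nat DIM('a) * (\<integral>\<^sup>+ s. \<integral>\<^sup>+ x. ?G x s \<partial>lborel \<partial>lborel)"
    by (subst lborel_pair.Fubini') simp_all
  also have "\<dots> = of_nat DIM('a) * (\<integral>\<^sup>+ s. \<integral>\<^sup>+ y. ?H s y \<partial>lborel \<partial>lborel)"
    by (simp only: inner)
  also have "\<dots> = of_nat DIM('a) * (\<integral>\<^sup>+ y. \<integral>\<^sup>+ s. ?H s y \<partial>lborel \<partial>lborel)"
    using Hm by (subst lborel_pair.Fubini') (simp_all add: case_prod_beta')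
  also have "\<dots> = (\<integral>\<^sup>+ y. of_nat DIM('a) * (\<integral>\<^sup>+ s. ?H s y \<partial>lborel) \<partial>lborel)"
  proof (rule nn_integral_cmult[symmetric])
    have "(\<lambda>p. ?H (snd p) (fst p)) \<in> borel_measurable (borel \<Otimes>\<^sub>M borel)"
      using measurable_compose[OF measurable_pair_swap' Hm] by (simp add: case_prod_beta')
    then show "(\<lambda>y. \<integral>\<^sup>+ s. ?H s y \<partial>lborel) \<in> borel_measurable lborel"
      by (intro lborel.borel_measurable_nn_integral) (simp add: case_prod_beta')
  qed
  also have "\<dots> = (\<integral>\<^sup>+ y. F y \<partial>lborel)"
    using AE_lborel_singleton[of "0::'a"] by (intro nn_integral_cong_AE) (auto simp: outer)
  finally show ?thesis ..
qed

section \<open>Invariance under isometries and the constant \<open>K_const\<close>\<close>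

lemma nn_integral_lborel_translate:
  fixes g :: "'a::euclidean_space \<Rightarrow> ennreal"
  assumes "g \<in> borel_measurable borel"
  shows "(\<integral>\<^sup>+ x. g (t + x) \<partial>lborel) = (\<integral>\<^sup>+ x. g x \<partial>lborel)"
  using nn_integral_lborel_affine[OF assms, of 1 t] by simp

text \<open>By Tonelli, any two translation-invariant measures are proportional; the unit ball fixes the
  factor.\<close>

lemma nn_integral_lborel_isometry:
  fixes g :: "'a::euclidean_space \<Rightarrow> ennreal"
  assumes [measurable]: "g \<in> borel_measurable borel" and T: "linear T"
    and inv: "\<And>x. T (T x) = x" and iso: "\<And>x. norm (T x) = norm x"
  shows "(\<integral>\<^sup>+ x. g (T x) \<partial>lborel) = (\<integral>\<^sup>+ x. g x \<partial>lborel)"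
proof -
  let ?h = "\<lambda>x::'a. indicator (ball 0 1) x :: ennreal"
  have [measurable]: "T \<in> borel_measurable borel"
    using T by (simp add: borel_measurable_continuous_onI linear_continuous_on linear_linear)
  have h[measurable]: "(\<lambda>x. ?h x) \<in> borel_measurable borel"
    by (intro borel_measurable_indicator) simp
  \<comment> \<open>Since \<open>T\<close> is its own inverse, y - T x = - T (x - T y), and the ball
    is symmetric about 0. This recentres the integral over \<open>x\<close> at \<open>T y\<close>,
    where a translation removes \<open>y\<close>.\<close>
  have hsym: "?h (y - T x) = ?h (T (x + - T y))" for x y
    using T inv by (simp add: linear_diff iso norm_minus_commute indicator_def)
  have Tadd: "T (T y + x) = y + T x" for x y
    using T inv by (simp add: linear_add)
  have [measurable]: "(\<lambda>p. ?h (snd p - T (fst p))) \<in> borel_measurable (borel \<Otimes>\<^sub>M borel)"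
    by (rule measurable_compose[OF _ h]) measurable
  have "emeasure lborel (ball (0::'a) 1) * (\<integral>\<^sup>+ x. g (T x) \<partial>lborel)
      = (\<integral>\<^sup>+ y. ?h y * (\<integral>\<^sup>+ x. g (T x) \<partial>lborel) \<partial>lborel)"
    using h by (simp add: nn_integral_multc)
  also have "\<dots> = (\<integral>\<^sup>+ y. \<integral>\<^sup>+ x. ?h y * g (y + T x) \<partial>lborel \<partial>lborel)"
  proof (rule nn_integral_cong)
    fix y
    have "(\<integral>\<^sup>+ x. g (T x) \<partial>lborel) = (\<integral>\<^sup>+ x. g (T (T y + x)) \<partial>lborel)"
      by (rule nn_integral_lborel_translate[symmetric]) measurable
    then show "?h y * (\<integral>\<^sup>+ x. g (T x) \<partial>lborel) = (\<integral>\<^sup>+ x. ?h y * g (y + T x) \<partial>lborel)"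
      by (simp add: Tadd nn_integral_cmult)
  qed
  also have "\<dots> = (\<integral>\<^sup>+ x. \<integral>\<^sup>+ y. ?h y * g (y + T x) \<partial>lborel \<partial>lborel)"
    by (subst lborel_pair.Fubini') simp_all
  also have "\<dots> = (\<integral>\<^sup>+ x. \<integral>\<^sup>+ y. ?h (y - T x) * g y \<partial>lborel \<partial>lborel)"
  proof (rule nn_integral_cong)
    fix x
    have "(\<lambda>y. ?h (y - T x)) \<in> borel_measurable borel"
      by (rule measurable_compose[OF _ h]) measurable
    then show "(\<integral>\<^sup>+ y. ?h y * g (y + T x) \<partial>lborel) = (\<integral>\<^sup>+ y. ?h (y - T x) * g y \<partial>lborel)"
      using nn_integral_lborel_translate[of "\<lambda>y. ?h (y - T x) * g y" "T x"] by (simp add: add.commute)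
  qed
  also have "\<dots> = (\<integral>\<^sup>+ y. \<integral>\<^sup>+ x. ?h (y - T x) * g y \<partial>lborel \<partial>lborel)"
    by (subst lborel_pair.Fubini') (simp_all add: case_prod_beta')
  also have "\<dots> = (\<integral>\<^sup>+ y. emeasure lborel (ball (0::'a) 1) * g y \<partial>lborel)"
  proof (rule nn_integral_cong)
    fix y
    have hT: "(\<lambda>x. ?h (T x)) \<in> borel_measurable borel"
      by (rule measurable_compose[OF _ h]) measurable
    have "(\<integral>\<^sup>+ x. ?h (y - T x) * g y \<partial>lborel) = (\<integral>\<^sup>+ x. ?h (T (- T y + x)) \<partial>lborel) * g y"
      unfolding hsym add.commute[of _ "- T y"]
      by (rule nn_integral_multc) (rule measurable_compose[OF _ h], measurable)
    also have "(\<integral>\<^sup>+ x. ?h (T (- T y + x)) \<partial>lborel) = (\<integral>\<^sup>+ x. ?h (T x) \<partial>lborel)"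
      by (rule nn_integral_lborel_translate[OF hT])
    also have "\<dots> = (\<integral>\<^sup>+ x. ?h x \<partial>lborel)"
      by (simp add: indicator_def iso)
    finally show "(\<integral>\<^sup>+ x. ?h (y - T x) * g y \<partial>lborel) = emeasure lborel (ball (0::'a) 1) * g y"
      by simp
  qed
  also have "\<dots> = emeasure lborel (ball (0::'a) 1) * (\<integral>\<^sup>+ y. g y \<partial>lborel)"
    by (rule nn_integral_cmult) simp
  finally have eq: "emeasure lborel (ball (0::'a) 1) * (\<integral>\<^sup>+ x. g (T x) \<partial>lborel)
      = emeasure lborel (ball (0::'a) 1) * (\<integral>\<^sup>+ y. g y \<partial>lborel)" .
  have "emeasure lborel (ball (0::'a) 1) \<noteq> 0"
    using content_ball_pos[of 1 "0::'a"] by (auto simp: measure_def)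
  moreover have "emeasure lborel (ball (0::'a) 1) \<noteq> top"
    using emeasure_lborel_ball_finite[of "0::'a" 1] by simp
  ultimately show ?thesis
    using eq by (simp add: ennreal_mult_cancel_left)
qed

text \<open>\<open>T\<close> commutes with \<open>sgn\<close> and preserves the punctured unit ball,
  so the sphere inherits the invariance of Lebesgue measure. Involutions suffice because any two
  distinct unit vectors are exchanged by a reflection.\<close>

lemma nn_integral_sphere_measure_isometry:
  fixes g :: "'a::euclidean_space \<Rightarrow> ennreal"
  assumes [measurable]: "g \<in> borel_measurable borel" and T: "linear T"
    and inv: "\<And>x. T (T x) = x" and iso: "\<And>x. norm (T x) = norm x"
  shows "(\<integral>\<^sup>+ \<theta>. g (T \<theta>) \<partial>sphere_measure) = (\<integral>\<^sup>+ \<theta>. g \<theta> \<partial>sphere_measure)"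
proof -
  let ?B = "ball 0 1 - {0} :: 'a set"
  have [measurable]: "?B \<in> sets borel"
    by (intro borel_open open_delete) simp
  have [measurable]: "T \<in> borel_measurable borel"
    using T by (simp add: borel_measurable_continuous_onI linear_continuous_on linear_linear)
  have sgnT: "T (sgn x) = sgn (T x)" for x
    using T iso by (simp add: sgn_div_norm linear_scale)
  have "T x = 0 \<longleftrightarrow> x = 0" for x
    using iso[of x] by (metis norm_eq_zero)
  then have indT: "indicator ?B x = (indicator ?B (T x) :: ennreal)" for x
    using iso[of x] by (simp add: indicator_def)
  have "(\<integral>\<^sup>+ x. indicator ?B x * g (T (sgn x)) \<partial>lborel)
      = (\<integral>\<^sup>+ x. indicator ?B (T x) * g (sgn (T x)) \<partial>lborel)"
    unfolding sgnT by (intro nn_integral_cong arg_cong2[where f="(*)"] indT refl)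
  also have "\<dots> = (\<integral>\<^sup>+ x. indicator ?B x * g (sgn x) \<partial>lborel)"
    by (rule nn_integral_lborel_isometry[OF _ T inv iso]) measurable
  finally show ?thesis
    by (subst (1 2) nn_integral_sphere_measure) measurable
qed

lemma K_const_unique:
  fixes e e' :: "'a::euclidean_space"
  assumes "norm e = 1" "norm e' = 1"
  shows "K_const e q = K_const e' q"
proof (cases "e = e'")
  case False
  define v where "v = e - e'"
  \<comment> \<open>the reflection that exchanges \<open>e\<close> and \<open>e'\<close>\<close>
  define T where "T x = x - (2 * (x \<bullet> v) / (v \<bullet> v)) *\<^sub>R v" for x
  have v: "v \<bullet> v \<noteq> 0" using False by (simp add: v_def)
  have vv: "v \<bullet> v = 2 - 2 * (e \<bullet> e')" "e \<bullet> v = 1 - e \<bullet> e'"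
    using assms by (simp_all add: v_def algebra_simps inner_commute norm_eq_1)
  have T: "linear T"
    unfolding T_def by (intro linearI) (simp_all add: algebra_simps add_divide_distrib)
  have Tv: "T x \<bullet> v = - (x \<bullet> v)" for x
    using v by (simp add: T_def inner_diff_left)
  have inv: "T (T x) = x" for x
    using Tv[of x] by (simp add: T_def[of "T x"]) (simp add: T_def)
  have inner: "T x \<bullet> T y = x \<bullet> y" for x y
  proof -
    have "T x \<bullet> T y = T x \<bullet> y - (2 * (y \<bullet> v) / (v \<bullet> v)) * (T x \<bullet> v)"
      by (simp add: T_def[of y] inner_diff_right)
    moreover have "T x \<bullet> y = x \<bullet> y - (2 * (x \<bullet> v) / (v \<bullet> v)) * (v \<bullet> y)"
      by (simp add: T_def inner_diff_left)
    ultimately show ?thesis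
      by (simp add: Tv inner_commute[of v y])
  qed
  \<comment> \<open>As \<open>e\<close> and \<open>e'\<close> are unit vectors, both sides equal 2 -
    2 (e . e'); hence the coefficient of \<open>v\<close> in \<open>T e\<close> is 1.\<close>
  have "2 * (e \<bullet> v) = v \<bullet> v" unfolding vv by simp
  with v have "T e = e - v"
    unfolding T_def by (metis divide_self scaleR_one)
  then have Te: "T e = e'"
    by (simp add: v_def)
  have "K_const e q = (\<integral>\<^sup>+ \<theta>. ennreal (\<bar>e' \<bullet> T \<theta>\<bar> powr q) \<partial>sphere_measure)"
    using inner[of e] by (simp add: K_const_def Te)
  also have "\<dots> = K_const e' q"
    unfolding K_const_def
    by (rule nn_integral_sphere_measure_isometry[OF _ T inv]) (simp_all add: norm_eq_sqrt_inner inner)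
  finally show ?thesis .
qed simp

text \<open>Here the direction of the gradient disappears: the integrand is homogeneous of degree q
  in \<open>v\<close>, and the remaining unit vector \<open>sgn v\<close> may be exchanged for
  \<open>e\<close>.\<close>

lemma nn_integral_sphere_inner_powr:
  fixes v e :: "'a::euclidean_space"
  assumes "norm e = 1" "q > 0"
  shows "(\<integral>\<^sup>+ \<theta>. ennreal (\<bar>v \<bullet> \<theta>\<bar> powr q) \<partial>sphere_measure) = ennreal (norm v powr q) * K_const e q"
proof (cases "v = 0")
  case False
  have "(\<integral>\<^sup>+ \<theta>. ennreal (\<bar>v \<bullet> \<theta>\<bar> powr q) \<partial>sphere_measure)
      = (\<integral>\<^sup>+ \<theta>. ennreal (norm v powr q) * ennreal (\<bar>sgn v \<bullet> \<theta>\<bar> powr q) \<partial>sphere_measure)"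
  proof (rule nn_integral_cong)
    fix \<theta>
    have "\<bar>v \<bullet> \<theta>\<bar> = norm v * \<bar>sgn v \<bullet> \<theta>\<bar>"
      using False by (simp add: sgn_div_norm abs_mult)
    then show "ennreal (\<bar>v \<bullet> \<theta>\<bar> powr q) = ennreal (norm v powr q) * ennreal (\<bar>sgn v \<bullet> \<theta>\<bar> powr q)"
      by (simp add: powr_mult ennreal_mult'')
  qed
  also have "\<dots> = ennreal (norm v powr q) * K_const (sgn v) q"
    unfolding K_const_def by (intro nn_integral_cmult measurable_sphere_measure) measurable
  also have "K_const (sgn v) q = K_const e q"
    using assms False by (intro K_const_unique) (simp_all add: norm_sgn)
  finally show ?thesis .
qed (use assms in simp)

text \<open>The total mass of the sphere is n times the volume of the unit ball. This bounds
  \<open>K_const\<close> and, later, the majorant for dominated convergence.\<close>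

lemma nn_integral_const_sphere_measure_finite:
  assumes "c < \<infinity>"
  shows "(\<integral>\<^sup>+ \<theta>. c \<partial>(sphere_measure :: 'a::euclidean_space measure)) < \<infinity>"
proof -
  have "emeasure lborel (ball (0::'a) 1 - {0}) \<le> emeasure lborel (ball (0::'a) 1)"
    by (intro emeasure_mono) auto
  also have "\<dots> < \<infinity>"
    using emeasure_lborel_ball_finite[of "0::'a" 1] by simp
  finally have "emeasure lborel (ball (0::'a) 1 - {0}) < \<infinity>" .
  moreover have "(\<integral>\<^sup>+ x. indicator (ball (0::'a) 1 - {0}) x * c \<partial>lborel) = emeasure lborel (ball (0::'a) 1 - {0}) * c"
  proof (subst nn_integral_multc)
    show "indicator (ball (0::'a) 1 - {0}) \<in> borel_measurable lborel"
      by (intro borel_measurable_indicator) (simp add: borel_open open_delete)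
  qed (simp add: borel_open open_delete)
  ultimately show ?thesis
    using assms by (subst nn_integral_sphere_measure) (simp_all add: ennreal_mult_less_top of_nat_less_top)
qed

text \<open>By Cauchy-Schwarz the integrand is at most 1. Finiteness lets the outer power 1/q pass
  to the limit.\<close>

lemma K_const_finite:
  assumes "norm (e::'a::euclidean_space) = 1" "q > 0"
  shows "K_const e q < \<infinity>"
proof -
  have "K_const e q \<le> (\<integral>\<^sup>+ \<theta>. 1 \<partial>(sphere_measure :: 'a measure))"
    unfolding K_const_def
  proof (rule nn_integral_mono)
    fix \<theta> :: 'a assume "\<theta> \<in> space sphere_measure"
    then have "\<bar>e \<bullet> \<theta>\<bar> \<le> 1"
      using Cauchy_Schwarz_ineq2[of e \<theta>] assms by (simp add: space_sphere_measure)
    then have "\<bar>e \<bullet> \<theta>\<bar> powr q \<le> 1 powr q"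
      using assms by (intro powr_mono2) auto
    then show "ennreal (\<bar>e \<bullet> \<theta>\<bar> powr q) \<le> 1" by simp
  qed
  also have "\<dots> < \<infinity>"
    by (rule nn_integral_const_sphere_measure_finite) simp
  finally show ?thesis .
qed

section \<open>Real powers and constant factors in [0,\<infinity>]\<close>

lemma ennreal_powr_ennreal: "0 \<le> a \<Longrightarrow> ennreal_powr (ennreal a) p = ennreal (a powr p)"
  by (simp add: ennreal_powr_def)

lemma ennreal_powr_mult:
  assumes "0 < a"
  shows "ennreal_powr (ennreal a * b) p = ennreal (a powr p) * ennreal_powr b p"
proof (cases b)
  case (real r)
  with assms show ?thesis
    by (simp add: ennreal_powr_ennreal powr_mult flip: ennreal_mult'')
next
  case top
  with assms show ?thesis
    by (simp add: ennreal_powr_def ennreal_mult_top)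
qed

lemma ennreal_powr_mono:
  assumes "a \<le> b" "0 \<le> p"
  shows "ennreal_powr a p \<le> ennreal_powr b p"
proof (cases b)
  case (real s)
  with assms obtain r where "a = ennreal r" "0 \<le> r"
    by (cases a) (auto simp: top_unique)
  with real assms show ?thesis
    by (simp add: ennreal_powr_ennreal ennreal_leI powr_mono2)
qed (simp add: ennreal_powr_def)

text \<open>A finite limit keeps \<open>g\<close> eventually away from \<infinity>, so that
  \<open>ennreal_powr\<close> is a real power there; p > 0 gives continuity also at the limit 0,
  which occurs when the gradient vanishes.\<close>

lemma tendsto_ennreal_powr:
  assumes g: "(g \<longlongrightarrow> a) F" and a: "a < \<infinity>" and p: "0 < p"
  shows "((\<lambda>t. ennreal_powr (g t) p) \<longlongrightarrow> ennreal_powr a p) F"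
proof -
  have "((\<lambda>t. enn2real (g t) powr p) \<longlongrightarrow> enn2real a powr p) F"
    using p a g by (intro tendsto_powr' tendsto_const tendsto_enn2real) (auto simp: less_top)
  then have "((\<lambda>t. ennreal (enn2real (g t) powr p)) \<longlongrightarrow> ennreal (enn2real a powr p)) F"
    by (rule tendsto_ennrealI)
  moreover have "eventually (\<lambda>t. g t < \<infinity>) F"
    using g a by (rule order_tendstoD)
  then have "eventually (\<lambda>t. ennreal (enn2real (g t) powr p) = ennreal_powr (g t) p) F"
    by (rule eventually_mono) (auto simp: ennreal_powr_def)
  ultimately have "((\<lambda>t. ennreal_powr (g t) p) \<longlongrightarrow> ennreal (enn2real a powr p)) F"
    by (rule Lim_transform_eventually)
  moreover have "ennreal_powr a p = ennreal (enn2real a powr p)"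
    using a by (simp add: ennreal_powr_def less_top)
  ultimately show ?thesis by simp
qed

text \<open>Measurability of \<open>g\<close> is not available when this is applied to the maximal function.\<close>

lemma nn_integral_cmult_le:
  assumes c: "0 < c"
  shows "(\<integral>\<^sup>+ x. ennreal c * g x \<partial>M) \<le> ennreal c * (\<integral>\<^sup>+ x. g x \<partial>M)"
  unfolding nn_integral_def[of M "\<lambda>x. ennreal c * g x"]
proof (rule SUP_least, clarify)
  fix s assume s: "simple_function M s" and le: "s \<le> (\<lambda>x. ennreal c * g x)"
  \<comment> \<open>Division by \<open>c\<close> turns a simple function below \<open>c g\<close>
    into one below \<open>g\<close>; only simple functions, which are measurable, then have the
    constant pulled out of their integral.\<close>
  let ?t = "\<lambda>x. ennreal (1 / c) * s x"
  have t: "simple_function M ?t"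
    using s by (intro simple_function_mult simple_function_const)
  have one: "ennreal c * (ennreal (1 / c) * y) = y" "ennreal (1 / c) * (ennreal c * y) = y" for y
    using c by (simp_all flip: mult.assoc ennreal_mult'')
  have tg: "?t x \<le> g x" for x
    using mult_left_mono[OF le_funD[OF le, of x], of "ennreal (1 / c)"] by (simp add: one)
  have "integral\<^sup>S M s = (\<integral>\<^sup>+ x. ennreal c * ?t x \<partial>M)"
    using s by (simp add: one nn_integral_eq_simple_integral)
  also have "\<dots> = ennreal c * (\<integral>\<^sup>+ x. ?t x \<partial>M)"
    using t by (intro nn_integral_cmult borel_measurable_simple_function)
  also have "\<dots> \<le> ennreal c * (\<integral>\<^sup>+ x. g x \<partial>M)"
    by (intro mult_left_mono nn_integral_mono tg) simp
  finally show "integral\<^sup>S M s \<le> ennreal c * (\<integral>\<^sup>+ x. g x \<partial>M)" .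
qed

section \<open>The integral along a single ray\<close>

lemma powr_less_iff:
  fixes x y a :: real
  assumes "0 < x" "0 < y"
  shows "0 < a \<Longrightarrow> x powr a < y powr a \<longleftrightarrow> x < y" "a < 0 \<Longrightarrow> x powr a < y powr a \<longleftrightarrow> y < x"
  using assms by (auto simp: powr_def mult_less_cancel_left)

text \<open>Dividing by r turns the condition into r^(\<gamma>/q) < D/l, that is r < c for \<gamma>
  > 0 and r > c for \<gamma> < 0, with c = (D/l)^(q/\<gamma>). On exactly this side r^(\<gamma>-1)
  is integrable, with integral c^\<gamma>/|\<gamma>|.\<close>

lemma radial_superlevel_integral:
  fixes \<gamma> q l D :: real
  assumes \<gamma>: "\<gamma> \<noteq> 0" and q: "0 < q" and l: "0 < l" and D: "0 \<le> D"
  shows "(\<integral>\<^sup>+ r\<in>{0<..}. indicator {r. l * r powr (1 + \<gamma> / q) < r * D} r * ennreal (r powr (\<gamma> - 1)) \<partial>lborel)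
    = ennreal ((D / l) powr q / \<bar>\<gamma>\<bar>)" (is "?I = _")
\<comment> \<open>For D = 0 the set is empty. The formula for \<open>c\<close> would then give
  \<open>0 powr _ = 0\<close>, and for \<gamma> < 0 the wrong set r > 0.\<close>
proof (cases "D = 0")
  case True
  have "l * r powr (1 + \<gamma> / q) \<ge> 0" for r using l by simp
  then have "?I = (\<integral>\<^sup>+ r. 0 \<partial>(lborel :: real measure))"
    by (intro nn_integral_cong) (simp add: True indicator_def not_less)
  with True show ?thesis by simp
next
  case False
  define c where "c = (D / l) powr (q / \<gamma>)"
  have c: "c > 0" and Dl: "c powr (\<gamma> / q) = D / l" and cg: "c powr \<gamma> = (D / l) powr q"
    using False D l \<gamma> q by (simp_all add: c_def powr_powr)
  have iff: "l * r powr (1 + \<gamma> / q) < r * D \<longleftrightarrow> r powr (\<gamma> / q) < c powr (\<gamma> / q)" if "r > 0" for r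
  proof -
    have "l * r powr (1 + \<gamma> / q) < r * D \<longleftrightarrow> r * (l * r powr (\<gamma> / q)) < r * D"
      using that by (simp add: powr_add ac_simps)
    also have "\<dots> \<longleftrightarrow> r powr (\<gamma> / q) < D / l"
      using that l by (simp add: mult_less_cancel_left field_simps)
    finally show ?thesis by (simp add: Dl)
  qed
  show ?thesis
  proof (cases "\<gamma> > 0")
    case True
    then have "l * r powr (1 + \<gamma> / q) < r * D \<longleftrightarrow> r < c" if "r > 0" for r
      using iff[OF that] powr_less_iff(1)[OF that c, of "\<gamma> / q"] q by simp
    then have "?I = (\<integral>\<^sup>+ r\<in>{0<..<c}. ennreal (r powr (\<gamma> - 1)) \<partial>lborel)"
      by (intro nn_integral_cong) (auto simp: indicator_def)
    also have "\<dots> = ennreal (c powr \<gamma> / \<gamma>)"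
      using True c by (subst nn_integral_powr_from_0) auto
    finally show ?thesis using True by (simp add: cg)
  next
    case neg: False
    then have "l * r powr (1 + \<gamma> / q) < r * D \<longleftrightarrow> c < r" if "r > 0" for r
      using iff[OF that] powr_less_iff(2)[OF that c, of "\<gamma> / q"] q \<gamma> by (simp add: divide_neg_pos)
    then have "?I = (\<integral>\<^sup>+ r\<in>{c<..}. ennreal (r powr (\<gamma> - 1)) \<partial>lborel)"
      using c by (intro nn_integral_cong) (auto simp: indicator_def)
    also have "\<dots> = ennreal (- (c powr \<gamma>) / \<gamma>)"
      using neg \<gamma> c by (subst nn_integral_powr_to_inf) auto
    finally show ?thesis using neg by (simp add: cg)
  qed
qed

section \<open>Superlevel integrals: scaling, upper bound, limit\<close>

text \<open>This is \<open>E1_integral\<close> with the base point moved to 0 and the increment made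
  an arbitrary function \<open>h\<close>, so that \<open>h\<close> can be rescaled, or replaced by a
  linear function or by L |z|.\<close>

definition superlevel_integral :: "real \<Rightarrow> real \<Rightarrow> real \<Rightarrow> ('a::euclidean_space \<Rightarrow> real) \<Rightarrow> ennreal" where
  "superlevel_integral q \<gamma> l h =
    (\<integral>\<^sup>+ z\<in>{z. l * norm z powr (1 + \<gamma> / q) < \<bar>h z\<bar>}. ennreal (norm z powr (\<gamma> - real DIM('a))) \<partial>lborel)"

lemma measurable_superlevel [measurable]:
  fixes h :: "'a::euclidean_space \<Rightarrow> real"
  assumes [measurable]: "h \<in> borel_measurable borel"
  shows "{z. l * norm z powr a < \<bar>h z\<bar>} \<in> sets borel"
  by measurable

lemma E1_integral_eq_superlevel:
  assumes [measurable]: "f \<in> borel_measurable borel"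
  shows "E1_integral x f l q \<gamma> = superlevel_integral q \<gamma> l (\<lambda>z. f (x + z) - f x)"
proof -
  have [measurable]: "E1 x f l q \<gamma> \<in> sets borel"
    unfolding E1_def by measurable
  have "E1_integral x f l q \<gamma> = (\<integral>\<^sup>+ z. ennreal (norm (x - (x + z)) powr (\<gamma> - real DIM('a))) * indicator (E1 x f l q \<gamma>) (x + z) \<partial>lborel)"
    unfolding E1_integral_def
    by (rule nn_integral_lborel_translate[symmetric]) measurable
  then show ?thesis
    by (simp add: superlevel_integral_def E1_def indicator_def abs_minus_commute)
qed

text \<open>The choice of \<open>\<epsilon>\<close> makes \<epsilon>^(\<gamma>/q) = 1/l, so the
  threshold l |\<epsilon> z|^(1+\<gamma>/q) becomes \<epsilon> |z|^(1+\<gamma>/q). The Jacobian and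
  the kernel contribute \<epsilon>^n \<epsilon>^(\<gamma>-n) = \<epsilon>^\<gamma> = l^(-q), which
  cancels the prefactor.\<close>

lemma superlevel_integral_scale:
  fixes h :: "'a::euclidean_space \<Rightarrow> real"
  assumes [measurable]: "h \<in> borel_measurable borel"
    and \<gamma>: "\<gamma> \<noteq> 0" and q: "0 < q" and l: "0 < l"
  defines "\<epsilon> \<equiv> l powr (- q / \<gamma>)"
  shows "ennreal (l powr q) * superlevel_integral q \<gamma> l h = superlevel_integral q \<gamma> 1 (\<lambda>z. h (\<epsilon> *\<^sub>R z) / \<epsilon>)"
proof -
  let ?n = "real DIM('a)"
  let ?G = "\<lambda>z. ennreal (norm z powr (\<gamma> - ?n)) * indicator {z. l * norm z powr (1 + \<gamma> / q) < \<bar>h z\<bar>} z"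
  have \<epsilon>: "\<epsilon> > 0"
    using l by (simp add: \<epsilon>_def)
  have "- q / \<gamma> * (\<gamma> / q) = - 1" "- q / \<gamma> * \<gamma> = - q"
    using \<gamma> q by simp_all
  then have \<epsilon>1: "\<epsilon> powr (\<gamma> / q) = 1 / l" and \<epsilon>2: "\<epsilon> powr \<gamma> = 1 / (l powr q)"
    using l unfolding \<epsilon>_def powr_powr by (simp_all add: powr_minus_divide)
  have "superlevel_integral q \<gamma> l h = ennreal (\<epsilon> ^ DIM('a)) * (\<integral>\<^sup>+ z. ?G (\<epsilon> *\<^sub>R z) \<partial>lborel)"
    unfolding superlevel_integral_def using \<epsilon>
    by (subst nn_integral_lborel_affine[where c=\<epsilon> and t=0]) (auto intro!: borel_measurable_times borel_measurable_indicator measurable_superlevel)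
  then have "ennreal (l powr q) * superlevel_integral q \<gamma> l h
      = ennreal (l powr q) * ennreal (\<epsilon> ^ DIM('a)) * (\<integral>\<^sup>+ z. ?G (\<epsilon> *\<^sub>R z) \<partial>lborel)"
    by (simp add: mult.assoc)
  also have "\<dots> = ennreal (l powr q * \<epsilon> powr ?n) * (\<integral>\<^sup>+ z. ?G (\<epsilon> *\<^sub>R z) \<partial>lborel)"
    using \<epsilon> by (simp add: powr_realpow ennreal_mult'')
  also have "\<dots> = (\<integral>\<^sup>+ z. ennreal (l powr q * \<epsilon> powr ?n) * ?G (\<epsilon> *\<^sub>R z) \<partial>lborel)"
    by (rule nn_integral_cmult[symmetric])
      (auto intro!: borel_measurable_times borel_measurable_indicator' measurable_superlevel)
  also have "\<dots> = superlevel_integral q \<gamma> 1 (\<lambda>z. h (\<epsilon> *\<^sub>R z) / \<epsilon>)"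
    unfolding superlevel_integral_def
  proof (rule nn_integral_cong)
    fix z :: 'a
    have "l * norm (\<epsilon> *\<^sub>R z) powr (1 + \<gamma> / q) = \<epsilon> * norm z powr (1 + \<gamma> / q)"
      using \<epsilon> l by (simp add: powr_mult powr_add \<epsilon>1)
    then have i: "indicator {z. l * norm z powr (1 + \<gamma> / q) < \<bar>h z\<bar>} (\<epsilon> *\<^sub>R z)
        = (indicator {z. 1 * norm z powr (1 + \<gamma> / q) < \<bar>h (\<epsilon> *\<^sub>R z) / \<epsilon>\<bar>} z :: ennreal)"
      using \<epsilon> by (simp add: indicator_def field_simps)
    have "l powr q * \<epsilon> powr ?n * norm (\<epsilon> *\<^sub>R z) powr (\<gamma> - ?n) = norm z powr (\<gamma> - ?n)"
      using \<epsilon> l by (simp add: powr_mult powr_diff \<epsilon>2)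
    then show "ennreal (l powr q * \<epsilon> powr ?n) * ?G (\<epsilon> *\<^sub>R z)
        = ennreal (norm z powr (\<gamma> - ?n)) * indicator {z. 1 * norm z powr (1 + \<gamma> / q) < \<bar>h (\<epsilon> *\<^sub>R z) / \<epsilon>\<bar>} z"
      using l \<epsilon> unfolding i by (simp flip: mult.assoc ennreal_mult'')
  qed
  finally show ?thesis .
qed

text \<open>The polar density r^(n-1) cancels the dimension in the kernel r^(\<gamma>-n) and leaves
  r^(\<gamma>-1).\<close>

lemma superlevel_integral_polar:
  fixes h :: "'a::euclidean_space \<Rightarrow> real"
  assumes [measurable]: "h \<in> borel_measurable borel"
  shows "superlevel_integral q \<gamma> l h = (\<integral>\<^sup>+ \<theta>. (\<integral>\<^sup>+ r\<in>{0<..}.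
    indicator {r. l * r powr (1 + \<gamma> / q) < \<bar>h (r *\<^sub>R \<theta>)\<bar>} r * ennreal (r powr (\<gamma> - 1)) \<partial>lborel) \<partial>sphere_measure)"
  unfolding superlevel_integral_def
proof (subst nn_integral_polar)
  show "(\<lambda>z::'a. ennreal (norm z powr (\<gamma> - real DIM('a))) * indicator {z. l * norm z powr (1 + \<gamma> / q) < \<bar>h z\<bar>} z) \<in> borel_measurable borel"
    by (auto intro!: borel_measurable_times borel_measurable_indicator measurable_superlevel)
next
  have "ennreal (norm (r *\<^sub>R \<theta>) powr (\<gamma> - real DIM('a))) * indicator {z. l * norm z powr (1 + \<gamma> / q) < \<bar>h z\<bar>} (r *\<^sub>R \<theta>)
      * ennreal (r powr (real DIM('a) - 1)) * indicator {0<..} r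
    = indicator {r. l * r powr (1 + \<gamma> / q) < \<bar>h (r *\<^sub>R \<theta>)\<bar>} r * ennreal (r powr (\<gamma> - 1)) * indicator {0<..} r"
    if "norm \<theta> = 1" for \<theta> :: 'a and r
    using that by (auto simp: indicator_def simp flip: ennreal_mult'' powr_add)
  then show "(\<integral>\<^sup>+ \<theta>. (\<integral>\<^sup>+ r\<in>{0<..}. ennreal (norm (r *\<^sub>R \<theta>) powr (\<gamma> - real DIM('a)))
      * indicator {z. l * norm z powr (1 + \<gamma> / q) < \<bar>h z\<bar>} (r *\<^sub>R \<theta>) * ennreal (r powr (real DIM('a) - 1)) \<partial>lborel) \<partial>sphere_measure)
    = (\<integral>\<^sup>+ \<theta>. (\<integral>\<^sup>+ r\<in>{0<..}.
    indicator {r. l * r powr (1 + \<gamma> / q) < \<bar>h (r *\<^sub>R \<theta>)\<bar>} r * ennreal (r powr (\<gamma> - 1)) \<partial>lborel) \<partial>(sphere_measure :: 'a measure))"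
    by (intro nn_integral_cong) (simp add: space_sphere_measure)
qed

text \<open>Enlarging the set on each ray to l r^(1+\<gamma>/q) < r N(\<theta>) makes the radial
  integral explicit; where N(\<theta>) = \<infinity> there is nothing to prove. \<open>N\<close>
  takes values in [0,\<infinity>] without measurability so that the maximal function fits. A
  constant \<open>N\<close> serves for the majorant in the limit.\<close>

lemma superlevel_integral_le:
  fixes h :: "'a::euclidean_space \<Rightarrow> real"
  assumes [measurable]: "h \<in> borel_measurable borel"
    and \<gamma>: "\<gamma> \<noteq> 0" and q: "0 < q" and l: "0 < l"
    and bd: "\<And>r \<theta>. r > 0 \<Longrightarrow> norm \<theta> = 1 \<Longrightarrow> ennreal \<bar>h (r *\<^sub>R \<theta>)\<bar> \<le> ennreal r * N \<theta>"
  shows "ennreal (l powr q) * superlevel_integral q \<gamma> l h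
    \<le> ennreal (1 / \<bar>\<gamma>\<bar>) * (\<integral>\<^sup>+ \<theta>. ennreal_powr (N \<theta>) q \<partial>sphere_measure)"
proof -
  let ?c = "1 / (l powr q * \<bar>\<gamma>\<bar>)"
  have "superlevel_integral q \<gamma> l h \<le> (\<integral>\<^sup>+ \<theta>. ennreal ?c * ennreal_powr (N \<theta>) q \<partial>sphere_measure)"
    unfolding superlevel_integral_polar[OF assms(1)]
  proof (rule nn_integral_mono)
    fix \<theta> :: 'a assume "\<theta> \<in> space sphere_measure"
    then have \<theta>: "norm \<theta> = 1" by (simp add: space_sphere_measure)
    show "(\<integral>\<^sup>+ r\<in>{0<..}. indicator {r. l * r powr (1 + \<gamma> / q) < \<bar>h (r *\<^sub>R \<theta>)\<bar>} r * ennreal (r powr (\<gamma> - 1)) \<partial>lborel)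
      \<le> ennreal ?c * ennreal_powr (N \<theta>) q"
    proof (cases "N \<theta>")
      case (real D)
      have "\<bar>h (r *\<^sub>R \<theta>)\<bar> \<le> r * D" if "r > 0" for r
        using bd[OF that \<theta>] that real by (simp flip: ennreal_mult'')
      then have "(\<integral>\<^sup>+ r\<in>{0<..}. indicator {r. l * r powr (1 + \<gamma> / q) < \<bar>h (r *\<^sub>R \<theta>)\<bar>} r * ennreal (r powr (\<gamma> - 1)) \<partial>lborel)
        \<le> (\<integral>\<^sup>+ r\<in>{0<..}. indicator {r. l * r powr (1 + \<gamma> / q) < r * D} r * ennreal (r powr (\<gamma> - 1)) \<partial>lborel)"
        by (intro nn_integral_mono) (auto simp: indicator_def dest: less_le_trans)
      also have "\<dots> = ennreal ?c * ennreal_powr (N \<theta>) q"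
        using real l \<gamma> by (simp add: radial_superlevel_integral \<gamma> q l ennreal_powr_ennreal powr_divide flip: ennreal_mult'')
      finally show ?thesis .
    next
      case top
      with l \<gamma> show ?thesis by (simp add: ennreal_powr_def ennreal_mult_top)
    qed
  qed
  also have "\<dots> \<le> ennreal ?c * (\<integral>\<^sup>+ \<theta>. ennreal_powr (N \<theta>) q \<partial>sphere_measure)"
    using l \<gamma> by (intro nn_integral_cmult_le) simp
  finally have "ennreal (l powr q) * superlevel_integral q \<gamma> l h
    \<le> ennreal (l powr q) * (ennreal ?c * (\<integral>\<^sup>+ \<theta>. ennreal_powr (N \<theta>) q \<partial>sphere_measure))"
    by (rule mult_left_mono) simp
  also have "\<dots> = ennreal (1 / \<bar>\<gamma>\<bar>) * (\<integral>\<^sup>+ \<theta>. ennreal_powr (N \<theta>) q \<partial>sphere_measure)"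
    using l by (simp flip: mult.assoc ennreal_mult'')
  finally show ?thesis .
qed

lemma superlevel_integral_inner:
  fixes v e :: "'a::euclidean_space"
  assumes \<gamma>: "\<gamma> \<noteq> 0" and q: "0 < q" and e: "norm e = 1"
  shows "superlevel_integral q \<gamma> 1 (\<lambda>z. v \<bullet> z) = ennreal (norm v powr q / \<bar>\<gamma>\<bar>) * K_const e q"
proof -
  have "superlevel_integral q \<gamma> 1 (\<lambda>z. v \<bullet> z) = (\<integral>\<^sup>+ \<theta>. (\<integral>\<^sup>+ r\<in>{0<..}.
    indicator {r. 1 * r powr (1 + \<gamma> / q) < r * \<bar>v \<bullet> \<theta>\<bar>} r * ennreal (r powr (\<gamma> - 1)) \<partial>lborel) \<partial>sphere_measure)"
    by (subst superlevel_integral_polar) (auto simp: indicator_def abs_mult intro!: nn_integral_cong)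
  also have "\<dots> = (\<integral>\<^sup>+ \<theta>. ennreal (1 / \<bar>\<gamma>\<bar>) * ennreal (\<bar>v \<bullet> \<theta>\<bar> powr q) \<partial>sphere_measure)"
    by (subst radial_superlevel_integral) (auto simp: \<gamma> q simp flip: ennreal_mult'')
  also have "\<dots> = ennreal (1 / \<bar>\<gamma>\<bar>) * (ennreal (norm v powr q) * K_const e q)"
    by (simp add: nn_integral_cmult measurable_sphere_measure nn_integral_sphere_inner_powr[OF e q])
  finally show ?thesis
    by (simp flip: mult.assoc ennreal_mult'')
qed

text \<open>On the ray through \<theta> the equation reads r^(a-1) = |v . \<theta>|, with at most
  one solution r > 0, so polar coordinates give measure zero. For a = 1 whole rays could satisfy it.
  The set excluded here is where strict inequality in the limit can be unstable.\<close>

lemma AE_norm_powr_neq_inner: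
  fixes v :: "'a::euclidean_space"
  assumes a: "a \<noteq> 1"
  shows "AE z in lborel. z \<noteq> 0 \<longrightarrow> norm z powr a \<noteq> \<bar>v \<bullet> z\<bar>"
proof -
  let ?N = "{z::'a. z \<noteq> 0 \<and> norm z powr a = \<bar>v \<bullet> z\<bar>}"
  have [measurable]: "?N \<in> sets borel" by measurable
  have "emeasure lborel ?N = (\<integral>\<^sup>+ z. indicator ?N z \<partial>lborel)" by simp
  also have "\<dots> = (\<integral>\<^sup>+ \<theta>. (\<integral>\<^sup>+ r\<in>{0<..}. indicator ?N (r *\<^sub>R \<theta>) * ennreal (r powr (real DIM('a) - 1)) \<partial>lborel) \<partial>sphere_measure)"
    by (rule nn_integral_polar) simp
  also have "\<dots> = (\<integral>\<^sup>+ \<theta>. 0 \<partial>(sphere_measure :: 'a measure))"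
  proof (rule nn_integral_cong)
    fix \<theta> :: 'a assume "\<theta> \<in> space sphere_measure"
    then have \<theta>: "norm \<theta> = 1" by (simp add: space_sphere_measure)
    have "r *\<^sub>R \<theta> \<notin> ?N" if r: "r > 0" "r \<noteq> \<bar>v \<bullet> \<theta>\<bar> powr (1 / (a - 1))" for r
    proof
      assume "r *\<^sub>R \<theta> \<in> ?N"
      then have "r powr a = r * \<bar>v \<bullet> \<theta>\<bar>"
        using r \<theta> by (simp add: abs_mult)
      then have "\<bar>v \<bullet> \<theta>\<bar> = r powr (a - 1)"
        using r by (simp add: powr_diff)
      then have "\<bar>v \<bullet> \<theta>\<bar> powr (1 / (a - 1)) = r"
        using r a by (simp add: powr_powr)
      with r show False by simp
    qed
    then have "(\<integral>\<^sup>+ r\<in>{0<..}. indicator ?N (r *\<^sub>R \<theta>) * ennreal (r powr (real DIM('a) - 1)) \<partial>lborel) = (\<integral>\<^sup>+ r. 0 \<partial>(lborel :: real measure))"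
      using AE_lborel_singleton[of "\<bar>v \<bullet> \<theta>\<bar> powr (1 / (a - 1))"]
      by (intro nn_integral_cong_AE) (auto simp: indicator_def)
    then show "(\<integral>\<^sup>+ r\<in>{0<..}. indicator ?N (r *\<^sub>R \<theta>) * ennreal (r powr (real DIM('a) - 1)) \<partial>lborel) = 0"
      by simp
  qed
  finally have "?N \<in> null_sets lborel"
    by (simp add: null_sets_def)
  then show ?thesis
    by (rule AE_I') auto
qed

text \<open>The majorant is the integrand belonging to L |z|. Its integral is finite by
  \<open>superlevel_integral_le\<close> with the constant \<open>L\<close> as \<open>N\<close>,
  since the sphere has finite mass.\<close>

lemma superlevel_integral_tendsto:
  fixes h :: "nat \<Rightarrow> 'a::euclidean_space \<Rightarrow> real" and v :: 'a
  assumes h[measurable]: "\<And>k. h k \<in> borel_measurable borel"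
    and \<gamma>: "\<gamma> \<noteq> 0" and q: "0 < q" and L: "0 \<le> L"
    and bd: "\<And>k z. \<bar>h k z\<bar> \<le> L * norm z"
    and lim: "\<And>z. (\<lambda>k. h k z) \<longlonglongrightarrow> v \<bullet> z"
  shows "(\<lambda>k. superlevel_integral q \<gamma> 1 (h k)) \<longlonglongrightarrow> superlevel_integral q \<gamma> 1 (\<lambda>z. v \<bullet> z)"
  unfolding superlevel_integral_def
proof (rule nn_integral_dominated_convergence)
  let ?p = "\<lambda>z::'a. ennreal (norm z powr (\<gamma> - real DIM('a)))"
  let ?w = "\<lambda>z. ?p z * indicator {z. 1 * norm z powr (1 + \<gamma> / q) < \<bar>L * norm z\<bar>} z"
  show "(\<lambda>z. ?p z * indicator {z. 1 * norm z powr (1 + \<gamma> / q) < \<bar>h k z\<bar>} z) \<in> borel_measurable lborel" for k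
    by (auto intro!: borel_measurable_times borel_measurable_indicator measurable_superlevel h)
  show "(\<lambda>z. ?p z * indicator {z. 1 * norm z powr (1 + \<gamma> / q) < \<bar>v \<bullet> z\<bar>} z) \<in> borel_measurable lborel"
    by (auto intro!: borel_measurable_times borel_measurable_indicator measurable_superlevel)
  show "?w \<in> borel_measurable lborel"
    by (auto intro!: borel_measurable_times borel_measurable_indicator measurable_superlevel)
  show "AE z in lborel. ?p z * indicator {z. 1 * norm z powr (1 + \<gamma> / q) < \<bar>h k z\<bar>} z \<le> ?w z" for k
  proof (rule AE_I2)
    fix z
    have "\<bar>h k z\<bar> \<le> \<bar>L * norm z\<bar>" using bd[of k z] L by simp
    then show "?p z * indicator {z. 1 * norm z powr (1 + \<gamma> / q) < \<bar>h k z\<bar>} z \<le> ?w z"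
      by (auto simp: indicator_def dest: less_le_trans)
  qed
  have "integral\<^sup>N lborel ?w = superlevel_integral q \<gamma> 1 (\<lambda>z::'a. L * norm z)"
    by (simp only: superlevel_integral_def)
  also have "\<dots> \<le> ennreal (1 / \<bar>\<gamma>\<bar>) * (\<integral>\<^sup>+ \<theta>. ennreal_powr (ennreal L) q \<partial>(sphere_measure :: 'a measure))"
    using superlevel_integral_le[of "\<lambda>z::'a. L * norm z" \<gamma> q 1 "\<lambda>_. ennreal L"] \<gamma> q L
    by (simp add: mult.commute flip: ennreal_mult'')
  also have "\<dots> < \<infinity>"
  proof -
    have "(\<integral>\<^sup>+ \<theta>. ennreal_powr (ennreal L) q \<partial>(sphere_measure :: 'a measure)) < \<infinity>"
      using L by (intro nn_integral_const_sphere_measure_finite) (simp add: ennreal_powr_ennreal)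
    then show ?thesis by (simp add: ennreal_mult_less_top)
  qed
  finally show "integral\<^sup>N lborel ?w < \<infinity>" .
  show "AE z in lborel. (\<lambda>k. ?p z * indicator {z. 1 * norm z powr (1 + \<gamma> / q) < \<bar>h k z\<bar>} z)
      \<longlonglongrightarrow> ?p z * indicator {z. 1 * norm z powr (1 + \<gamma> / q) < \<bar>v \<bullet> z\<bar>} z"
  proof (rule AE_mp[OF AE_norm_powr_neq_inner[of "1 + \<gamma> / q" v]])
    show "1 + \<gamma> / q \<noteq> 1" using \<gamma> q by simp
    show "AE z in lborel. (z \<noteq> 0 \<longrightarrow> norm z powr (1 + \<gamma> / q) \<noteq> \<bar>v \<bullet> z\<bar>) \<longrightarrow>
      (\<lambda>k. ?p z * indicator {z. 1 * norm z powr (1 + \<gamma> / q) < \<bar>h k z\<bar>} z)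
      \<longlonglongrightarrow> ?p z * indicator {z. 1 * norm z powr (1 + \<gamma> / q) < \<bar>v \<bullet> z\<bar>} z"
    proof (rule AE_I2, rule impI)
      fix z
      assume elim: "z \<noteq> 0 \<longrightarrow> norm z powr (1 + \<gamma> / q) \<noteq> \<bar>v \<bullet> z\<bar>"
      show "(\<lambda>k. ?p z * indicator {z. 1 * norm z powr (1 + \<gamma> / q) < \<bar>h k z\<bar>} z)
        \<longlonglongrightarrow> ?p z * indicator {z. 1 * norm z powr (1 + \<gamma> / q) < \<bar>v \<bullet> z\<bar>} z"
      \<comment> \<open>At the origin the weight is \<open>0 powr _ = 0\<close>, so the sequence and
        its limit both vanish.\<close>
      proof (cases "z = 0")
        case False
        with elim \<gamma> q have ne: "norm z powr (1 + \<gamma> / q) \<noteq> \<bar>v \<bullet> z\<bar>" by simp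
        have l: "(\<lambda>k. \<bar>h k z\<bar>) \<longlonglongrightarrow> \<bar>v \<bullet> z\<bar>"
          by (intro tendsto_rabs lim)
        \<comment> \<open>Off the equality set both the strict inequality and its strict reverse
          persist under convergence, so the indicators are eventually constant.\<close>
        have "eventually (\<lambda>k. norm z powr (1 + \<gamma> / q) < \<bar>h k z\<bar> \<longleftrightarrow> norm z powr (1 + \<gamma> / q) < \<bar>v \<bullet> z\<bar>) sequentially"
        proof (cases "norm z powr (1 + \<gamma> / q) < \<bar>v \<bullet> z\<bar>")
          case True
          then show ?thesis using order_tendstoD(1)[OF l True] by simp
        next
          case False
          with ne have "\<bar>v \<bullet> z\<bar> < norm z powr (1 + \<gamma> / q)" by simp
          from order_tendstoD(2)[OF l this] show ?thesis
            by (rule eventually_mono) (use False in auto)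
        qed
        then have "eventually (\<lambda>k. ?p z * indicator {z. 1 * norm z powr (1 + \<gamma> / q) < \<bar>h k z\<bar>} z
            = ?p z * indicator {z. 1 * norm z powr (1 + \<gamma> / q) < \<bar>v \<bullet> z\<bar>} z) sequentially"
          by (rule eventually_mono) (simp add: indicator_def)
        then show ?thesis by (rule tendsto_eventually)
      qed simp
    qed
  qed
qed

section \<open>Gradients, the Lipschitz bound and the maximal function\<close>

text \<open>\<open>gradient\<close> is a definite description, so existence and uniqueness are both
  due: the vector is assembled from the derivative on \<open>Basis\<close>, and two candidates are
  compared on their difference.\<close>

lemma GDERIV_gradient:
  assumes "f differentiable (at x)"
  shows "GDERIV f x :> gradient f x"
proof -
  obtain f' where f': "(f has_derivative f') (at x)"
    using assms by (auto simp: differentiable_def)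
  define D where "D = (\<Sum>b\<in>Basis. f' b *\<^sub>R b)"
  have "f' h = h \<bullet> D" for h
  proof -
    have "f' h = f' (\<Sum>b\<in>Basis. (h \<bullet> b) *\<^sub>R b)"
      by (simp add: euclidean_representation)
    also have "\<dots> = h \<bullet> D"
      using has_derivative_linear[OF f']
      by (simp add: D_def inner_sum_right linear_sum linear_scale mult.commute)
    finally show ?thesis .
  qed
  then have "f' = (\<lambda>h. h \<bullet> D)" by (rule ext)
  with f' have D: "GDERIV f x :> D" by (simp add: gderiv_def)
  show ?thesis
    unfolding gradient_def
  proof (rule theI[where P="\<lambda>D. GDERIV f x :> D", OF D])
    fix E assume "GDERIV f x :> E"
    with D have "(\<lambda>h. h \<bullet> D) = (\<lambda>h. h \<bullet> E)"
      unfolding gderiv_def by (rule has_derivative_unique)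
    then have "(E - D) \<bullet> D = (E - D) \<bullet> E" by (rule fun_cong)
    then have "(E - D) \<bullet> (E - D) = 0" by (simp add: inner_diff_right)
    then show "E = D" by simp
  qed
qed

lemma gradient_eq_0:
  assumes "x \<notin> closure {x. f x \<noteq> (0::real)}"
  shows "gradient f x = 0"
proof -
  let ?U = "- closure {x. f x \<noteq> 0}"
  have U: "open ?U"
    by (intro open_Compl closed_closure)
  have 0: "0 = f y" if "y \<in> ?U" for y
    using that subsetD[OF closure_subset, of y "{x. f x \<noteq> 0}"] by (metis ComplD mem_Collect_eq)
  have "((\<lambda>_. 0 :: real) has_derivative (\<lambda>h. h \<bullet> 0)) (at x)"
    by simp
  then have "(f has_derivative (\<lambda>h. h \<bullet> 0)) (at x)"
    by (rule has_derivative_transform_within_open[OF _ U _ 0]) (use assms in blast)+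
  then have D: "GDERIV f x :> 0" by (simp add: gderiv_def)
  then have "GDERIV f x :> gradient f x"
    by (intro GDERIV_gradient) (auto simp: gderiv_def differentiable_def)
  with D have "(\<lambda>h. h \<bullet> 0) = (\<lambda>h. h \<bullet> gradient f x)"
    unfolding gderiv_def by (rule has_derivative_unique)
  then have "gradient f x \<bullet> 0 = gradient f x \<bullet> gradient f x"
    by (rule fun_cong)
  then show ?thesis by simp
qed

lemma bounded_gradient:
  assumes "C1_compact_support f"
  obtains L where "0 \<le> L" "\<And>x. norm (gradient f x) \<le> L"
proof -
  let ?S = "closure {x. f x \<noteq> 0}"
  have "compact (gradient f ` ?S)"
    using assms by (intro compact_continuous_image) (auto simp: C1_compact_support_def intro: continuous_on_subset)
  then obtain L where L: "\<And>x. x \<in> ?S \<Longrightarrow> norm (gradient f x) \<le> L"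
    using compact_imp_bounded bounded_iff by (metis imageI)
  \<comment> \<open>If the support is empty, \<open>L\<close> is unconstrained and may be
    negative.\<close>
  have "norm (gradient f x) \<le> max 0 L" for x
    using L[of x] gradient_eq_0[of x f] by (cases "x \<in> ?S") auto
  then show ?thesis using that[of "max 0 L"] by auto
qed

text \<open>Mean value inequality. It bounds all difference quotients by L |z| uniformly in
  \<epsilon>, which is the domination needed for the limit.\<close>

lemma gradient_Lipschitz:
  fixes f :: "'a::euclidean_space \<Rightarrow> real"
  assumes f: "\<And>x. f differentiable (at x)" and L: "\<And>x. norm (gradient f x) \<le> L"
  shows "\<bar>f (x + z) - f x\<bar> \<le> L * norm z"
proof -
  have "norm (f (x + z) - f x) \<le> L * norm (x + z - x)"
  proof (rule differentiable_bound[where S=UNIV and f'="\<lambda>y h. h \<bullet> gradient f y"])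
    show "(f has_derivative (\<lambda>h. h \<bullet> gradient f y)) (at y within UNIV)" for y
      using GDERIV_gradient[OF f, of y] by (simp add: gderiv_def)
    show "onorm (\<lambda>h. h \<bullet> gradient f y) \<le> L" for y
    proof (rule onorm_le)
      fix h
      have "norm (h \<bullet> gradient f y) \<le> norm h * norm (gradient f y)"
        by (rule Cauchy_Schwarz_ineq2[unfolded real_norm_def[symmetric]])
      also have "\<dots> \<le> L * norm h"
        using L[of y] by (subst mult.commute) (intro mult_right_mono, auto)
      finally show "norm (h \<bullet> gradient f y) \<le> L * norm h" .
    qed
  qed auto
  then show ?thesis by simp
qed

lemma DERIV_line:
  fixes f :: "'a::euclidean_space \<Rightarrow> real"
  assumes f: "f differentiable (at (x + s *\<^sub>R z))"
  shows "((\<lambda>t. f (x + t *\<^sub>R z)) has_real_derivative gradient f (x + s *\<^sub>R z) \<bullet> z) (at s)"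
proof -
  have "((\<lambda>t. x + t *\<^sub>R z) has_derivative (\<lambda>t. t *\<^sub>R z)) (at s)"
    by (auto intro!: derivative_eq_intros)
  from has_derivative_compose[OF this GDERIV_gradient[OF f, unfolded gderiv_def]] show ?thesis
    by (simp add: has_field_derivative_def inner_commute mult_commute_abs)
qed

text \<open>The fundamental theorem of calculus along the segment bounds the increment by the
  integral of |grad f| over [0,r], that is, r times one of the averages in the supremum.\<close>

lemma increment_le_dir_maximal:
  fixes f :: "'a::euclidean_space \<Rightarrow> real"
  assumes f: "\<And>x. f differentiable (at x)" and cont: "continuous_on UNIV (gradient f)"
    and r: "r > 0" and \<theta>: "norm \<theta> = 1"
  shows "ennreal \<bar>f (x + r *\<^sub>R \<theta>) - f x\<bar> \<le> ennreal r * dir_maximal \<theta> (\<lambda>z. norm (gradient f z)) x"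
proof -
  let ?g = "\<lambda>s. norm (gradient f (x + s *\<^sub>R \<theta>))" and ?g' = "\<lambda>s. gradient f (x + s *\<^sub>R \<theta>) \<bullet> \<theta>"
  have cg: "continuous_on {0..r} (\<lambda>s. gradient f (x + s *\<^sub>R \<theta>))"
    by (intro continuous_on_compose2[OF cont] continuous_intros) auto
  have int: "?g integrable_on {0..r}" "?g' integrable_on {0..r}"
    by (intro integrable_continuous_interval continuous_intros cg)+
  have "(?g' has_integral f (x + r *\<^sub>R \<theta>) - f (x + 0 *\<^sub>R \<theta>)) {0..r}"
    using r by (intro fundamental_theorem_of_calculus)
      (auto simp flip: has_real_derivative_iff_has_vector_derivative intro!: has_field_derivative_at_within DERIV_line f)
  then have "f (x + r *\<^sub>R \<theta>) - f x = integral {0..r} ?g'"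
    by (simp add: integral_unique)
  also have "norm \<dots> \<le> integral {0..r} ?g"
  proof (rule integral_norm_bound_integral[OF int(2,1)])
    show "norm (?g' s) \<le> ?g s" for s
      using Cauchy_Schwarz_ineq2[of "gradient f (x + s *\<^sub>R \<theta>)" \<theta>] \<theta> by simp
  qed
  finally have "ennreal \<bar>f (x + r *\<^sub>R \<theta>) - f x\<bar> \<le> ennreal (integral {0..r} ?g)"
    by (simp add: ennreal_leI)
  also have "\<dots> = (\<integral>\<^sup>+ s\<in>{0..r}. ennreal \<bar>?g s\<bar> \<partial>lborel)"
    using nn_integral_has_integral_lebesgue'[OF _ integrable_integral[OF int(1)]] by simp
  also have "\<dots> = ennreal r * (ennreal (1 / r) * (\<integral>\<^sup>+ s\<in>{0..r}. ennreal \<bar>?g s\<bar> \<partial>lborel))"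
    using r by (simp flip: mult.assoc ennreal_mult'')
  also have "\<dots> \<le> ennreal r * dir_maximal \<theta> (\<lambda>z. norm (gradient f z)) x"
    unfolding dir_maximal_def using r by (intro mult_left_mono SUP_upper) auto
  finally show ?thesis .
qed

section \<open>The limit of the rescaled integrals as \<epsilon> tends to 0+\<close>

lemma superlevel_integral_difference_quotient_tendsto:
  fixes f :: "'a::euclidean_space \<Rightarrow> real" and x e :: 'a
  assumes f: "C1_compact_support f" and \<gamma>: "\<gamma> \<noteq> 0" and q: "0 < q" and e: "norm e = 1"
  shows "((\<lambda>\<epsilon>. superlevel_integral q \<gamma> 1 (\<lambda>z. (f (x + \<epsilon> *\<^sub>R z) - f x) / \<epsilon>))
    \<longlongrightarrow> ennreal (norm (gradient f x) powr q / \<bar>\<gamma>\<bar>) * K_const e q) (at_right 0)"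
proof -
  let ?v = "gradient f x"
  have diff: "\<And>y. f differentiable (at y)"
    using f by (simp add: C1_compact_support_def)
  then have "continuous_on UNIV f"
    by (intro differentiable_imp_continuous_on) (simp add: differentiable_on_def)
  then have [measurable]: "f \<in> borel_measurable borel"
    by (rule borel_measurable_continuous_onI)
  obtain L where L: "0 \<le> L" "\<And>y. norm (gradient f y) \<le> L"
    using bounded_gradient[OF f] by blast
  have "((\<lambda>\<epsilon>. superlevel_integral q \<gamma> 1 (\<lambda>z. (f (x + \<epsilon> *\<^sub>R z) - f x) / \<epsilon>))
    \<longlongrightarrow> superlevel_integral q \<gamma> 1 (\<lambda>z. ?v \<bullet> z)) (at_right 0)"
    \<comment> \<open>Dominated convergence is a statement about sequences, so the one-sided limit
      is tested along arbitrary positive null sequences.\<close>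
    unfolding tendsto_at_iff_sequentially comp_def
  proof (intro allI impI)
    fix X :: "nat \<Rightarrow> real" assume X: "\<forall>i. X i \<in> {0<..} - {0}" "X \<longlonglongrightarrow> 0"
    show "(\<lambda>k. superlevel_integral q \<gamma> 1 (\<lambda>z. (f (x + X k *\<^sub>R z) - f x) / X k))
      \<longlonglongrightarrow> superlevel_integral q \<gamma> 1 (\<lambda>z. ?v \<bullet> z)"
    proof (rule superlevel_integral_tendsto[OF _ \<gamma> q L(1)])
      show "(\<lambda>z. (f (x + X k *\<^sub>R z) - f x) / X k) \<in> borel_measurable borel" for k
        by measurable
      show "\<bar>(f (x + X k *\<^sub>R z) - f x) / X k\<bar> \<le> L * norm z" for k z
      proof -
        have "X k > 0" using X by simp
        then show ?thesis
          using gradient_Lipschitz[OF diff L(2), where x=x and z="X k *\<^sub>R z"] by (simp add: field_simps)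
      qed
      show "(\<lambda>k. (f (x + X k *\<^sub>R z) - f x) / X k) \<longlonglongrightarrow> ?v \<bullet> z" for z
      proof -
        have "((\<lambda>t. (f (x + t *\<^sub>R z) - f x) / t) \<longlongrightarrow> ?v \<bullet> z) (at 0)"
          using DERIV_line[OF diff, where x=x and s=0 and z=z] by (simp add: DERIV_def)
        moreover have "filterlim X (at 0) sequentially"
          using X by (simp add: filterlim_at less_imp_neq[symmetric])
        ultimately show ?thesis
          by (rule filterlim_compose)
      qed
    qed
  qed
  moreover have "superlevel_integral q \<gamma> 1 (\<lambda>z. ?v \<bullet> z) = ennreal (norm ?v powr q / \<bar>\<gamma>\<bar>) * K_const e q"
    by (rule superlevel_integral_inner[OF \<gamma> q e])
  ultimately show ?thesis by (simp only:)
qed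

section \<open>From the scale \<epsilon> back to the level l\<close>

theorem theorem3p4:
  fixes f :: "'a::euclidean_space \<Rightarrow> real" and \<gamma> q :: real and x e :: 'a
  assumes "\<gamma> \<noteq> 0" and "0 < q" and "C1_compact_support f" and "norm e = 1"
  shows "(\<gamma> > 0 \<longrightarrow>
      ((\<lambda>l. ennreal l * ennreal_powr (E1_integral x f l q \<gamma>) (1 / q)) \<longlongrightarrow>
        ennreal_powr (K_const e q) (1 / q) / ennreal (\<gamma> powr (1 / q)) * ennreal (norm (gradient f x)))
        at_top) \<and>
    (\<gamma> < 0 \<longrightarrow>
      ((\<lambda>l. ennreal l * ennreal_powr (E1_integral x f l q \<gamma>) (1 / q)) \<longlongrightarrow>
        ennreal_powr (K_const e q) (1 / q) / ennreal ((- \<gamma>) powr (1 / q)) * ennreal (norm (gradient f x)))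
        (at_right 0)) \<and>
    (SUP l\<in>{0<..}. ennreal l * ennreal_powr (E1_integral x f l q \<gamma>) (1 / q))
      \<le> ennreal (\<bar>\<gamma>\<bar> powr (- 1 / q)) *
        ennreal_powr (\<integral>\<^sup>+ \<theta>. ennreal_powr (dir_maximal \<theta> (\<lambda>z. norm (gradient f z)) x) q
          \<partial>sphere_measure) (1 / q)"
proof -
  note \<gamma> = assms(1) and q = assms(2) and f = assms(3) and e = assms(4)
  let ?h = "\<lambda>z. f (x + z) - f x" and ?K = "ennreal_powr (K_const e q) (1 / q)"
  let ?A = "\<lambda>\<epsilon>. superlevel_integral q \<gamma> 1 (\<lambda>z. (f (x + \<epsilon> *\<^sub>R z) - f x) / \<epsilon>)"
  let ?Phi = "\<lambda>l. ennreal l * ennreal_powr (E1_integral x f l q \<gamma>) (1 / q)"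
  let ?\<epsilon> = "\<lambda>l. l powr (- q / \<gamma>)"
  define R where "R = ennreal_powr (ennreal (norm (gradient f x) powr q / \<bar>\<gamma>\<bar>) * K_const e q) (1 / q)"
  have diff: "\<And>y. f differentiable (at y)" and cont: "continuous_on UNIV (gradient f)"
    using f by (simp_all add: C1_compact_support_def)
  then have "continuous_on UNIV f"
    by (intro differentiable_imp_continuous_on) (simp add: differentiable_on_def)
  then have fm[measurable]: "f \<in> borel_measurable borel"
    by (rule borel_measurable_continuous_onI)
  \<comment> \<open>The factor l = (l^q)^(1/q) moves under the outer power and becomes the prefactor
    that the scaling identity and the upper bound absorb.\<close>
  have Phi: "?Phi l = ennreal_powr (ennreal (l powr q) * superlevel_integral q \<gamma> l ?h) (1 / q)" if "l > 0" for l
    using that q by (simp add: ennreal_powr_mult powr_powr E1_integral_eq_superlevel[OF fm])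
  have PhiA: "?Phi l = ennreal_powr (?A (?\<epsilon> l)) (1 / q)" if "l > 0" for l
    unfolding Phi[OF that] using that \<gamma> q by (subst superlevel_integral_scale) auto
  have A: "((\<lambda>\<epsilon>. ennreal_powr (?A \<epsilon>) (1 / q)) \<longlongrightarrow> R) (at_right 0)"
    unfolding R_def using q K_const_finite[OF e q]
    by (intro tendsto_ennreal_powr superlevel_integral_difference_quotient_tendsto f \<gamma> e)
      (simp_all add: ennreal_mult_less_top)
  \<comment> \<open>\<open>ennreal_powr_mult\<close> asks for a positive real factor, so a vanishing
    gradient is treated apart; both sides are then 0.\<close>
  have R: "R = ?K / ennreal (\<bar>\<gamma>\<bar> powr (1 / q)) * ennreal (norm (gradient f x))"
  proof (cases "gradient f x = 0")
    case True
    then show ?thesis by (simp add: R_def ennreal_powr_def)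
  next
    case False
    then have "R = ennreal (norm (gradient f x) / \<bar>\<gamma>\<bar> powr (1 / q)) * ?K"
      using \<gamma> q by (simp add: R_def ennreal_powr_mult powr_divide powr_powr)
    also have "\<dots> = ?K / ennreal (\<bar>\<gamma>\<bar> powr (1 / q)) * ennreal (norm (gradient f x))"
      using \<gamma> by (simp add: divide_ennreal_def inverse_ennreal ennreal_mult'' divide_inverse ac_simps)
    finally show ?thesis .
  qed
  \<comment> \<open>Both limits are instances of this: the exponent -q/\<gamma> is negative for
    \<gamma> > 0 and positive for \<gamma> < 0, so \<epsilon> tends to 0+ as l tends to \<infinity>
    or to 0+ respectively.\<close>
  have lim: "(?Phi \<longlongrightarrow> R) F" if "filterlim ?\<epsilon> (at_right 0) F" "eventually (\<lambda>l. l > 0) F" for F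
  proof (rule Lim_transform_eventually)
    show "((\<lambda>l. ennreal_powr (?A (?\<epsilon> l)) (1 / q)) \<longlongrightarrow> R) F"
      using A that(1) by (rule filterlim_compose)
    show "eventually (\<lambda>l. ennreal_powr (?A (?\<epsilon> l)) (1 / q) = ?Phi l) F"
      using that(2) by (rule eventually_mono) (simp only: PhiA)
  qed
  have pos: "(?Phi \<longlongrightarrow> R) at_top" if "\<gamma> > 0"
  proof (rule lim)
    have "(?\<epsilon> \<longlongrightarrow> 0) at_top"
      using that q by (intro tendsto_neg_powr filterlim_ident) (simp add: divide_neg_pos)
    then show "filterlim ?\<epsilon> (at_right 0) at_top"
      by (auto simp: filterlim_at intro: eventually_mono[OF eventually_gt_at_top[of 0]])
  qed (rule eventually_gt_at_top)
  have neg: "(?Phi \<longlongrightarrow> R) (at_right 0)" if "\<gamma> < 0"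
  proof (rule lim)
    have gt: "eventually (\<lambda>l. l > (0::real)) (at_right 0)"
      by (rule eventually_at_right_less)
    have "(?\<epsilon> \<longlongrightarrow> 0 powr (- q / \<gamma>)) (at_right 0)"
      using that q gt by (intro tendsto_powr' tendsto_const tendsto_ident_at)
        (auto simp: divide_pos_neg elim: eventually_mono)
    then show "filterlim ?\<epsilon> (at_right 0) (at_right 0)"
      by (auto simp: filterlim_at intro: eventually_mono[OF gt])
  qed (rule eventually_at_right_less)
  have sup: "?Phi l \<le> ennreal (\<bar>\<gamma>\<bar> powr (- 1 / q)) *
        ennreal_powr (\<integral>\<^sup>+ \<theta>. ennreal_powr (dir_maximal \<theta> (\<lambda>z. norm (gradient f z)) x) q
          \<partial>sphere_measure) (1 / q)" (is "_ \<le> _ * ennreal_powr ?M _") if "l > 0" for l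
  proof -
    have "ennreal (l powr q) * superlevel_integral q \<gamma> l ?h \<le> ennreal (1 / \<bar>\<gamma>\<bar>) * ?M"
      using increment_le_dir_maximal[OF diff cont]
      by (intro superlevel_integral_le \<gamma> q that) auto
    then have "?Phi l \<le> ennreal_powr (ennreal (1 / \<bar>\<gamma>\<bar>) * ?M) (1 / q)"
      unfolding Phi[OF that] using q by (intro ennreal_powr_mono) auto
    also have "\<dots> = ennreal (\<bar>\<gamma>\<bar> powr (- 1 / q)) * ennreal_powr ?M (1 / q)"
      using \<gamma> by (simp add: ennreal_powr_mult powr_divide powr_minus_divide)
    finally show ?thesis .
  qed
  show ?thesis
  proof (intro conjI impI)
    show "(SUP l\<in>{0<..}. ?Phi l) \<le> ennreal (\<bar>\<gamma>\<bar> powr (- 1 / q)) *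
        ennreal_powr (\<integral>\<^sup>+ \<theta>. ennreal_powr (dir_maximal \<theta> (\<lambda>z. norm (gradient f z)) x) q
          \<partial>sphere_measure) (1 / q)"
      by (rule SUP_least) (rule sup, simp)
  qed (use pos neg in \<open>simp_all add: R\<close>)
qed

end
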